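(* Let $H$ be a complex Hilbert space, and let $T$ be an injective bounded linear operator on $H$ such that $W(T^{-1})=\mathbb{C}$. If $\lambda,\mu\in\mathbb{C}$ with $\lambda\ne\mu$ and if $I+\mu T$ is invertible, then \[ \|(I+\lambda T)(I+\mu T)^{-1}\|>1 . \]
   Context: The inner product is linear in its first argument. $I$ is the identity operator on $H$, and $\|\cdot\|$ is the operator norm. For an injective bounded operator $T$ on $H$, $T^{-1}$ denotes the (possibly unbounded) operator with domain $D(T^{-1})=T(H)$ inverse to $T$. For a (possibly unbounded) operator $A$ with domain $D(A)\subset H$, the numerical range of $A$ is $W(A):=\{\langle Ax,x\rangle : x\in D(A),\ \|x\|=1\}$. *)

theory Defs
  imports "HOL-Analysis.Analysis"
begin

text \<open>
  A complex inner product is added on top of \<^class>\<open>real_normed_vector\<close>, so that the library's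
  norm, topology, completeness, \<^const>\<open>bounded_linear\<close> and \<^const>\<open>onorm\<close> apply. The class axioms
  tie the inherited real scaling and norm to the complex structure. The inner product is linear
  in its first argument.
\<close>

class complex_inner = real_normed_vector +
  fixes scaleC :: "complex \<Rightarrow> 'a \<Rightarrow> 'a" (infixr "*\<^sub>C" 75)
    and cinner :: "'a \<Rightarrow> 'a \<Rightarrow> complex"
  assumes scaleC_add_right: "a *\<^sub>C (x + y) = a *\<^sub>C x + a *\<^sub>C y"
    and scaleC_add_left: "(a + b) *\<^sub>C x = a *\<^sub>C x + b *\<^sub>C x"
    and scaleC_scaleC: "a *\<^sub>C b *\<^sub>C x = (a * b) *\<^sub>C x"
    and scaleC_one: "1 *\<^sub>C x = x"
    and scaleR_scaleC: "r *\<^sub>R x = complex_of_real r *\<^sub>C x"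
    and cinner_add_left: "cinner (x + y) z = cinner x z + cinner y z"
    and cinner_scaleC_left: "cinner (a *\<^sub>C x) y = a * cinner x y"
    and cinner_commute: "cinner x y = cnj (cinner y x)"
    and cinner_ge_zero: "0 \<le> Re (cinner x x)"
    and cinner_eq_zero_iff: "cinner x x = 0 \<longleftrightarrow> x = 0"
    and norm_eq_sqrt_cinner: "norm x = sqrt (Re (cinner x x))"

class complex_hilbert_space = complex_inner + complete_space

definition bounded_clinear :: "('a::complex_inner \<Rightarrow> 'b::complex_inner) \<Rightarrow> bool"
  where "bounded_clinear T \<longleftrightarrow> bounded_linear T \<and> (\<forall>c x. T (c *\<^sub>C x) = c *\<^sub>C T x)"

text \<open>Invertibility in the algebra of bounded operators.\<close>

definition invertible_op :: "('a::complex_inner \<Rightarrow> 'a) \<Rightarrow> bool"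
  where "invertible_op A \<longleftrightarrow> (\<exists>B. bounded_clinear B \<and> B \<circ> A = id \<and> A \<circ> B = id)"

text \<open>
  A possibly unbounded operator is given by a function \<open>A\<close> together with its domain \<open>D\<close>;
  the values of \<open>A\<close> outside \<open>D\<close> are irrelevant. In particular, the inverse of an injective
  operator \<open>T\<close> is the function \<open>inv T\<close> with domain \<open>range T\<close>.
\<close>

definition numerical_range :: "'a::complex_inner set \<Rightarrow> ('a \<Rightarrow> 'a) \<Rightarrow> complex set"
  where "numerical_range D A = {cinner (A x) x | x. x \<in> D \<and> norm x = 1}"

end

theory Submission
  imports Defs
begin

text \<open>
  If the norm were at most 1, then \<open>\<parallel>x + \<lambda> T x\<parallel> \<le> \<parallel>x + \<mu> T x\<parallel>\<close> for every \<open>x\<close>, because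
  \<open>I + \<mu> T\<close> is invertible. Expanding both squares, the terms \<open>\<parallel>x\<parallel>\<^sup>2\<close> cancel, and
  with \<open>y = T x\<close> normalised to \<open>\<parallel>y\<parallel> = 1\<close> what remains is
  \<open>2 Re (cnj (\<lambda> - \<mu>) \<langle>T\<^sup>-\<^sup>1 y, y\<rangle>) \<le> \<bar>\<mu>\<bar>\<^sup>2 - \<bar>\<lambda>\<bar>\<^sup>2\<close>. As \<open>\<lambda> \<noteq> \<mu>\<close>, this confines
  \<open>W(T\<^sup>-\<^sup>1)\<close> to a closed half-plane, whereas it is the whole plane by assumption.
\<close>

lemma norm_sq_eq_Re_cinner: "(norm (x::'a::complex_inner))\<^sup>2 = Re (cinner x x)"
  by (simp add: norm_eq_sqrt_cinner cinner_ge_zero)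

lemma cinner_add_right: "cinner (x::'a::complex_inner) (y + z) = cinner x y + cinner x z"
  by (metis cinner_add_left cinner_commute complex_cnj_add)

lemma cinner_scaleC_right: "cinner (x::'a::complex_inner) (c *\<^sub>C y) = cnj c * cinner x y"
  by (metis cinner_scaleC_left cinner_commute complex_cnj_mult)

lemma norm_scaleC: "norm (c *\<^sub>C (x::'a::complex_inner)) = cmod c * norm x"
proof -
  have "cinner (c *\<^sub>C x) (c *\<^sub>C x) = complex_of_real ((cmod c)\<^sup>2) * cinner x x"
    by (simp only: cinner_scaleC_left cinner_scaleC_right complex_norm_square mult_ac)
  then have "(norm (c *\<^sub>C x))\<^sup>2 = (cmod c * norm x)\<^sup>2"
    by (simp add: norm_sq_eq_Re_cinner power_mult_distrib del: of_real_power)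
  then show ?thesis by simp
qed

lemma norm_sq_add_scaleC:
  fixes x y :: "'a::complex_inner"
  shows "(norm (x + c *\<^sub>C y))\<^sup>2 =
    (norm x)\<^sup>2 + 2 * Re (cnj c * cinner x y) + (cmod c)\<^sup>2 * (norm y)\<^sup>2"
proof -
  have "Re (cinner (c *\<^sub>C y) x) = Re (cinner x (c *\<^sub>C y))"
    by (metis cinner_commute complex_cnj(1) complex.collapse cnj.sel(1))
  then have "(norm (x + c *\<^sub>C y))\<^sup>2 =
      (norm x)\<^sup>2 + 2 * Re (cinner x (c *\<^sub>C y)) + (norm (c *\<^sub>C y))\<^sup>2"
    by (simp add: norm_sq_eq_Re_cinner cinner_add_left cinner_add_right)
  then show ?thesis
    by (simp only: cinner_scaleC_right norm_scaleC power_mult_distrib)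
qed

lemma bounded_linear_scaleC_right: "bounded_linear (\<lambda>x::'a::complex_inner. c *\<^sub>C x)"
proof (rule bounded_linear_intro)
  show "c *\<^sub>C (x + y) = c *\<^sub>C x + c *\<^sub>C y" for x y :: 'a
    by (rule scaleC_add_right)
  show "c *\<^sub>C (r *\<^sub>R x) = r *\<^sub>R (c *\<^sub>C x)" for r and x :: 'a
    by (simp add: scaleR_scaleC scaleC_scaleC mult.commute)
  show "norm (c *\<^sub>C x) \<le> norm x * cmod c" for x :: 'a
    by (simp add: norm_scaleC)
qed

lemma bounded_linear_id_plus_scaleC:
  assumes "bounded_linear (T :: 'a::complex_inner \<Rightarrow> 'a)"
  shows "bounded_linear (\<lambda>x. x + c *\<^sub>C T x)"
  by (intro bounded_linear_add bounded_linear_ident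
      bounded_linear_compose[OF bounded_linear_scaleC_right assms])

text \<open>
  Every \<open>x\<close> is the image of \<open>A x\<close> under the bounded operator \<open>inv A\<close>, so a bound on
  the operator norm of a right quotient \<open>S A\<^sup>-\<^sup>1\<close> compares \<open>S\<close> with \<open>A\<close> pointwise.
\<close>

lemma norm_le_of_onorm_comp_inv_le_1:
  fixes S A :: "'a::complex_inner \<Rightarrow> 'a"
  assumes "bounded_linear S" "invertible_op A" "onorm (S \<circ> inv A) \<le> 1"
  shows "norm (S x) \<le> norm (A x)"
proof -
  obtain B where B: "bounded_clinear B" "B \<circ> A = id" "A \<circ> B = id"
    using assms(2) unfolding invertible_op_def by blast
  have inv: "inv A = B"
    using B by (simp add: inv_unique_comp)
  have "bounded_linear (S \<circ> inv A)"
    using bounded_linear_compose[OF assms(1), of B] B(1)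
    by (simp add: inv bounded_clinear_def comp_def)
  from onorm[OF this, of "A x"] have "norm (S (B (A x))) \<le> onorm (S \<circ> inv A) * norm (A x)"
    by (simp add: inv)
  also have "\<dots> \<le> 1 * norm (A x)"
    using assms(3) by (intro mult_right_mono) simp_all
  finally show ?thesis
    using B(2) by (simp add: pointfree_idE)
qed

theorem theorem1p3:
  fixes T :: "'a::complex_hilbert_space \<Rightarrow> 'a" and lam \<mu> :: complex
  assumes "bounded_clinear T"
    and "inj T"
    and "numerical_range (range T) (inv T) = UNIV"
    and "lam \<noteq> \<mu>"
    and "invertible_op (\<lambda>x. x + \<mu> *\<^sub>C T x)"
  shows "onorm ((\<lambda>x. x + lam *\<^sub>C T x) \<circ> inv (\<lambda>x. x + \<mu> *\<^sub>C T x)) > 1"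
proof (rule ccontr)
  assume "\<not> ?thesis"
  then have le: "norm (x + lam *\<^sub>C T x) \<le> norm (x + \<mu> *\<^sub>C T x)" for x
    using norm_le_of_onorm_comp_inv_le_1[OF bounded_linear_id_plus_scaleC assms(5)] assms(1)
    by (simp add: bounded_clinear_def)
  define K where "K = (cmod \<mu>)\<^sup>2 - (cmod lam)\<^sup>2"
  \<comment> \<open>A point just outside the half-plane: \<open>2 * Re (cnj (lam - \<mu>) * w) = K + 1\<close>.\<close>
  define w where "w = complex_of_real ((K + 1) / 2) / cnj (lam - \<mu>)"
  have "w \<in> numerical_range (range T) (inv T)"
    using assms(3) by simp
  then obtain x where x: "cinner x (T x) = w" "norm (T x) = 1"
    using assms(2) by (auto simp: numerical_range_def)
  have "(norm (x + lam *\<^sub>C T x))\<^sup>2 \<le> (norm (x + \<mu> *\<^sub>C T x))\<^sup>2"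
    by (simp add: le power_mono)
  then have "2 * Re (cnj (lam - \<mu>) * w) \<le> K"
    by (simp add: norm_sq_add_scaleC x K_def algebra_simps)
  moreover have "cnj (lam - \<mu>) * w = complex_of_real ((K + 1) / 2)"
    using assms(4) by (simp add: w_def del: complex_cnj_diff)
  then have "Re (cnj (lam - \<mu>) * w) = (K + 1) / 2"
    by (simp only: Re_complex_of_real)
  ultimately have "2 * ((K + 1) / 2) \<le> K"
    by (simp only:)
  then show False
    by simp
qed

end
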